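(* There exists a function $f:\mathbb{R}^2\to\mathbb{R}^2$ in $\mathrm{span}(\Phi_{\rm abs})$, given by an evaluation procedure and having a unique root $x^*$, such that the tangent mode piecewise linearization $\lozenge_{x^*}f$ is open in some neighborhood of $x^*$, while every neighborhood of $x^*$ contains a point $x$ such that all elements of the Clarke Jacobian of $f$ at $x$ are singular.
   Context: Elemental functions and PCS functions: $\Phi$ is a library of elemental functions consisting of the binary arithmetic operations and unary functions (such as $\sin,\cos,\exp,\log,\dots$), each differentiable with (locally) Lipschitz continuous derivative on its open domain; $\Phi_{\rm abs}=\Phi\cup\{\mathrm{abs}\}$ with $\mathrm{abs}(x)=|x|$. A function $F$ belongs to $\mathrm{span}(\Phi_{\rm abs})$ (is piecewise composite smooth, PCS) if it is computed by an evaluation procedure: a finite sequence of intermediate values $v_i$, beginning with the components of $x$ and ending with the components of $F(x)$, in which each further $v_i$ is $v_j\pm v_k$, $v_j * v_k$, $\varphi_i(v_j)$ with $\varphi_i\in\Phi$ unary, or $\mathrm{abs}(v_j)$ for earlier values $v_j,v_k$ (constants are allowed; maxima and minima are expressed via $\max(u,v)=\frac{u+v+|u-v|}2$, $\min(u,v)=\frac{u+v-|u-v|}2$). Tangent mode piecewise linearization at $\mathring x$: let $\mathring v_i$ be the values of the procedure at $\mathring x$. Starting from $\Delta x=x-\mathring x$, set $\Delta v_i=\Delta v_j\pm\Delta v_k$ if $v_i=v_j\pm v_k$; $\Delta v_i=\mathring v_j\Delta v_k+\Delta v_j\mathring v_k$ if $v_i=v_j*v_k$; $\Delta v_i=\varphi_i'(\mathring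 v_j)\Delta v_j$ if $v_i=\varphi_i(v_j)$; $\Delta v_i=|\mathring v_j+\Delta v_j|-|\mathring v_j|$ if $v_i=|v_j|$. The resulting output increment is $\Delta F(\mathring x;\Delta x)$, and $\lozenge_{\mathring x}F(x)=F(\mathring x)+\Delta F(\mathring x;x-\mathring x)$. A map is open in an open neighborhood $U$ of $x^*$ if it maps every open subset of $U$ to an open set. The Clarke Jacobian of a locally Lipschitz function at $x$ is the convex hull of all limits of Jacobians at differentiability points converging to $x$. *)

theory Defs
  imports "HOL-Analysis.Analysis"
begin

text \<open>A unary elemental is given together with its domain; values outside the domain are junk.
  The binary arithmetic operations and the absolute value are instructions in their own right
  (see below), so a library records only the unary smooth elementals.\<close>

type_synonym elemental = "real set \<times> (real \<Rightarrow> real)"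

definition locally_lipschitz_on :: "'a::metric_space set \<Rightarrow> ('a \<Rightarrow> 'b::metric_space) \<Rightarrow> bool" where
  "locally_lipschitz_on S g \<longleftrightarrow> (\<forall>x\<in>S. \<exists>e>0. \<exists>L. L-lipschitz_on (ball x e \<inter> S) g)"

definition elemental_library :: "elemental set \<Rightarrow> bool" where
  "elemental_library \<Phi> \<longleftrightarrow>
    (\<forall>(D, \<phi>)\<in>\<Phi>. open D \<and> (\<forall>t\<in>D. \<phi> field_differentiable (at t)) \<and>
                locally_lipschitz_on D (deriv \<phi>))"

text \<open>The natural numbers are positions (from 0) in the list of values computed so far,
  which starts with the components of the input.\<close>

datatype instr =
    Constant real
  | Add nat nat
  | Sub nat nat
  | Mul nat nat
  | Unary elemental nat
  | Abs nat

fun operands :: "instr \<Rightarrow> nat set" where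
  "operands (Constant c) = {}"
| "operands (Add j k) = {j, k}"
| "operands (Sub j k) = {j, k}"
| "operands (Mul j k) = {j, k}"
| "operands (Unary u j) = {j}"
| "operands (Abs j) = {j}"

fun elementals :: "instr \<Rightarrow> elemental set" where
  "elementals (Unary u j) = {u}"
| "elementals _ = {}"

text \<open>Procedures with \<open>n\<close> inputs and \<open>m\<close> outputs, the outputs being the last \<open>m\<close> values.\<close>

definition eval_procedure :: "elemental set \<Rightarrow> nat \<Rightarrow> nat \<Rightarrow> instr list \<Rightarrow> bool" where
  "eval_procedure \<Phi> n m P \<longleftrightarrow>
    (\<forall>i<length P. operands (P ! i) \<subseteq> {..<n + i} \<and> elementals (P ! i) \<subseteq> \<Phi>) \<and>
    m \<le> n + length P"

fun instr_val :: "real list \<Rightarrow> instr \<Rightarrow> real" where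
  "instr_val vs (Constant c) = c"
| "instr_val vs (Add j k) = vs ! j + vs ! k"
| "instr_val vs (Sub j k) = vs ! j - vs ! k"
| "instr_val vs (Mul j k) = vs ! j * vs ! k"
| "instr_val vs (Unary u j) = snd u (vs ! j)"
| "instr_val vs (Abs j) = \<bar>vs ! j\<bar>"

fun instr_defined :: "real list \<Rightarrow> instr \<Rightarrow> bool" where
  "instr_defined vs (Unary u j) \<longleftrightarrow> vs ! j \<in> fst u"
| "instr_defined vs _ \<longleftrightarrow> True"

fun run_vals :: "instr list \<Rightarrow> real list \<Rightarrow> real list" where
  "run_vals [] vs = vs"
| "run_vals (I # P) vs = run_vals P (vs @ [instr_val vs I])"

fun run_defined :: "instr list \<Rightarrow> real list \<Rightarrow> bool" where
  "run_defined [] vs \<longleftrightarrow> True"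
| "run_defined (I # P) vs \<longleftrightarrow> instr_defined vs I \<and> run_defined P (vs @ [instr_val vs I])"

text \<open>Here \<open>vs\<close> holds the values at the reference point and \<open>ds\<close> the increments.\<close>

fun instr_inc :: "real list \<Rightarrow> real list \<Rightarrow> instr \<Rightarrow> real" where
  "instr_inc vs ds (Constant c) = 0"
| "instr_inc vs ds (Add j k) = ds ! j + ds ! k"
| "instr_inc vs ds (Sub j k) = ds ! j - ds ! k"
| "instr_inc vs ds (Mul j k) = vs ! j * ds ! k + ds ! j * vs ! k"
| "instr_inc vs ds (Unary u j) = deriv (snd u) (vs ! j) * ds ! j"
| "instr_inc vs ds (Abs j) = \<bar>vs ! j + ds ! j\<bar> - \<bar>vs ! j\<bar>"

fun run_incs :: "instr list \<Rightarrow> real list \<Rightarrow> real list \<Rightarrow> real list" where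
  "run_incs [] vs ds = ds"
| "run_incs (I # P) vs ds = run_incs P (vs @ [instr_val vs I]) (ds @ [instr_inc vs ds I])"

definition coords :: "real^2 \<Rightarrow> real list" where
  "coords x = [x $ 1, x $ 2]"

definition outputs :: "real list \<Rightarrow> real^2" where
  "outputs vs = vector (drop (length vs - 2) vs)"

definition computes :: "elemental set \<Rightarrow> instr list \<Rightarrow> (real^2 \<Rightarrow> real^2) \<Rightarrow> bool" where
  "computes \<Phi> P f \<longleftrightarrow> eval_procedure \<Phi> 2 2 P \<and>
    (\<forall>x. run_defined P (coords x) \<and> f x = outputs (run_vals P (coords x)))"

definition span_abs :: "elemental set \<Rightarrow> (real^2 \<Rightarrow> real^2) set" where
  "span_abs \<Phi> = {f. \<exists>P. computes \<Phi> P f}"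

definition tangent_increment :: "instr list \<Rightarrow> real^2 \<Rightarrow> real^2 \<Rightarrow> real^2" where
  "tangent_increment P x0 dx = outputs (run_incs P (coords x0) (coords dx))"

definition tangent_linearization :: "instr list \<Rightarrow> real^2 \<Rightarrow> real^2 \<Rightarrow> real^2" where
  "tangent_linearization P x0 x =
    outputs (run_vals P (coords x0)) + tangent_increment P x0 (x - x0)"

definition open_map_in :: "'a::topological_space set \<Rightarrow> ('a \<Rightarrow> 'b::topological_space) \<Rightarrow> bool" where
  "open_map_in U g \<longleftrightarrow> (\<forall>V. open V \<and> V \<subseteq> U \<longrightarrow> open (g ` V))"

definition clarke_jacobian :: "(real^'n \<Rightarrow> real^'m) \<Rightarrow> real^'n \<Rightarrow> (real^'n^'m) set" where
  "clarke_jacobian f x = convex hull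
    {A. \<exists>X. (\<forall>k. f differentiable (at (X k))) \<and> X \<longlonglongrightarrow> x \<and>
            (\<lambda>k. jacobian f (at (X k))) \<longlonglongrightarrow> A}"

end

(* In f(x, y) = (2x, 2y + |y - x^2| - |y + x^2|) the squares have zero tangent at the root 0, so
   the two absolute values cancel in the linearization, which is twice the identity. But f itself
   collapses the region |y| < x^2 onto the first axis, and this region accumulates at 0. *)

theory Submission
  imports Defs
begin

text \<open>A sequence converging to \<open>x\<close> eventually stays in the open set
  \<open>S\<close>, where the Jacobian is constant, so its Jacobians can only tend to
  \<open>matrix L\<close>. A singleton is convex, so taking the hull adds nothing.\<close>

lemma clarke_jacobian_subset_singleton:
  fixes f :: "real^'n \<Rightarrow> real^'m"
  assumes "open S" "x \<in> S"
    and der: "\<And>z. z \<in> S \<Longrightarrow> (f has_derivative L) (at z)"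
  shows "clarke_jacobian f x \<subseteq> {matrix L}"
proof -
  have "A = matrix L"
    if "X \<longlonglongrightarrow> x" and A: "(\<lambda>k. jacobian f (at (X k))) \<longlonglongrightarrow> A" for A X
  proof -
    have "\<forall>\<^sub>F k in sequentially. X k \<in> S"
      using that(1) assms(1,2) by (rule topological_tendstoD)
    then have "\<forall>\<^sub>F k in sequentially. jacobian f (at (X k)) = matrix L"
      by eventually_elim (simp add: jacobian_def frechet_derivative_at[OF der, symmetric])
    then have "(\<lambda>k. jacobian f (at (X k))) \<longlonglongrightarrow> matrix L"
      by (rule tendsto_eventually)
    with A show ?thesis
      by (rule LIMSEQ_unique)
  qed
  then show ?thesis
    unfolding clarke_jacobian_def by (intro hull_minimal) auto
qed

definition collapse :: "real^2 \<Rightarrow> real^2" where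
  "collapse x = vector [2 * x $ 1, 2 * x $ 2 + \<bar>x $ 2 - (x $ 1)\<^sup>2\<bar> - \<bar>x $ 2 + (x $ 1)\<^sup>2\<bar>]"

text \<open>With inputs x, y at positions 0 and 1, the values from position 2 on are x^2, y - x^2,
  |y - x^2|, y + x^2, |y + x^2|, 2y, 2y + |y - x^2|, 2x and the second component. Computing 2x this
  late puts the two outputs last.\<close>

definition collapse_procedure :: "instr list" where
  "collapse_procedure =
    [Mul 0 0, Sub 1 2, Abs 3, Add 1 2, Abs 5, Add 1 1, Add 7 4, Add 0 0, Sub 8 6]"

lemma computes_collapse: "computes \<Phi> collapse_procedure collapse"
proof -
  have "eval_procedure \<Phi> 2 2 collapse_procedure"
    by (simp add: eval_procedure_def collapse_procedure_def All_less_Suc)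
  moreover have "run_defined collapse_procedure (coords x)"
    and "collapse x = outputs (run_vals collapse_procedure (coords x))" for x
    by (simp_all add: collapse_procedure_def collapse_def coords_def outputs_def power2_eq_square)
  ultimately show ?thesis
    by (simp add: computes_def)
qed

lemma tangent_linearization_collapse:
  "tangent_linearization collapse_procedure 0 = (*\<^sub>R) 2"
  by (rule ext) (simp add: tangent_linearization_def tangent_increment_def collapse_procedure_def
      coords_def outputs_def vec_eq_iff forall_2)

text \<open>The first component forces \<open>x $ 1 = 0\<close>; then the absolute values coincide
  and the second component reduces to \<open>2 * x $ 2\<close>.\<close>

lemma collapse_eq_0_iff: "collapse x = 0 \<longleftrightarrow> x = 0"
  by (auto simp: collapse_def vec_eq_iff forall_2)

text \<open>If |y| < x^2, then y - x^2 < 0 < y + x^2, so the absolute values contribute (x^2 - y) -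
  (y + x^2) = -2y, which cancels 2y. Hence \<open>collapse\<close> agrees with a linear map on an
  open set.\<close>

lemma has_derivative_collapse:
  assumes "\<bar>x $ 2\<bar> < (x $ 1)\<^sup>2"
  shows "(collapse has_derivative (\<lambda>v. vector [2 * v $ 1, 0])) (at x)"
proof (rule has_derivative_transform_within_open)
  have "linear (\<lambda>v :: real^2. vector [2 * v $ 1, 0] :: real^2)"
    by (rule linearI) (simp_all add: vec_eq_iff forall_2)
  then show "((\<lambda>v :: real^2. vector [2 * v $ 1, 0] :: real^2) has_derivative
      (\<lambda>v. vector [2 * v $ 1, 0])) (at x)"
    by (rule linear_imp_has_derivative)
  show "open {z :: real^2. \<bar>z $ 2\<bar> < (z $ 1)\<^sup>2}"
    by (intro open_Collect_less continuous_intros)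
qed (use assms in \<open>auto simp: collapse_def vec_eq_iff forall_2\<close>)

lemma clarke_jacobian_collapse_singular:
  assumes "\<bar>x $ 2\<bar> < (x $ 1)\<^sup>2" "A \<in> clarke_jacobian collapse x"
  shows "\<not> invertible A"
proof -
  let ?L = "\<lambda>v :: real^2. vector [2 * v $ 1, 0] :: real^2"
  let ?S = "{z :: real^2. \<bar>z $ 2\<bar> < (z $ 1)\<^sup>2}"
  have "clarke_jacobian collapse x \<subseteq> {matrix ?L}"
  proof (rule clarke_jacobian_subset_singleton)
    show "open ?S"
      by (intro open_Collect_less continuous_intros)
    show "x \<in> ?S"
      using assms(1) by simp
    show "(collapse has_derivative ?L) (at z)" if "z \<in> ?S" for z
      using that by (intro has_derivative_collapse) simp
  qed
  with assms(2) have "A = matrix ?L"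
    by (rule subsetD[THEN singletonD, rotated])
  \<comment> \<open>The second row of this matrix is zero, so its determinant vanishes.\<close>
  then show ?thesis
    by (simp add: invertible_det_nz det_2 matrix_def)
qed

theorem mainTheorem7:
  fixes \<Phi> :: "elemental set"
  assumes "elemental_library \<Phi>"
  shows "\<exists>f \<in> span_abs \<Phi>. \<exists>P xstar.
    computes \<Phi> P f \<and>
    (\<forall>x. f x = 0 \<longleftrightarrow> x = xstar) \<and>
    (\<exists>U. open U \<and> xstar \<in> U \<and> open_map_in U (tangent_linearization P xstar)) \<and>
    (\<forall>V. open V \<and> xstar \<in> V \<longrightarrow>
      (\<exists>x\<in>V. \<forall>A \<in> clarke_jacobian f x. \<not> invertible A))"
proof (rule bexI, intro exI conjI allI impI)
  show "computes \<Phi> collapse_procedure collapse"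
    by (rule computes_collapse)
  then show "collapse \<in> span_abs \<Phi>"
    by (auto simp: span_abs_def)
  show "collapse x = 0 \<longleftrightarrow> x = 0" for x
    by (rule collapse_eq_0_iff)
  \<comment> \<open>The whole plane serves as neighborhood, since scaling by 2 is open
    everywhere.\<close>
  show "open (UNIV :: (real^2) set)" "(0 :: real^2) \<in> UNIV"
    by simp_all
  show "open_map_in UNIV (tangent_linearization collapse_procedure 0)"
    by (auto simp: open_map_in_def tangent_linearization_collapse)
next
  fix V :: "(real^2) set"
  assume V: "open V \<and> 0 \<in> V"
  then obtain e where e: "e > 0" "ball 0 e \<subseteq> V"
    using open_contains_ball by blast
  \<comment> \<open>Nonzero points of the first axis lie in the collapsed region, and norm e/2 keeps
    this one inside the ball.\<close>
  define x :: "real^2" where "x = (e / 2) *\<^sub>R axis 1 1"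
  have "x \<in> V"
    using e by (auto simp: x_def)
  moreover have "\<bar>x $ 2\<bar> < (x $ 1)\<^sup>2"
    using e by (simp add: x_def axis_def)
  ultimately show "\<exists>x\<in>V. \<forall>A \<in> clarke_jacobian collapse x. \<not> invertible A"
    using clarke_jacobian_collapse_singular by blast
qed

end
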